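(* Let $r_0\in(0,1)$ and let $\Phi:[0,r_0)\to[0,+\infty]$ be a function of class $L^1([0,r_0))$ with respect to Lebesgue measure. Let $f$ be a holomorphic function on the open unit disc $\mathbb{D}\subset\mathbb{C}$ and assume that $$|f'(re^{i\theta})|\leq\Phi(1-r)\qquad\text{for all } r \text{ with } 1-r_0<r<1 \text{ and all } \theta\in\mathbb{R}.$$ Then $f$ extends continuously to $\partial\mathbb{D}$ (that is, $f$ extends to a continuous function on $\overline{\mathbb{D}}$).
   Context: $\mathbb{D}$ is the open unit disc in $\mathbb{C}$ centered at $0$. *)

theory Defs
  imports "HOL-Complex_Analysis.Complex_Analysis"
begin

end

theory Submission
  imports Defs
begin

text \<open>
  By the fundamental theorem of calculus along radii, on the unit circle the dilates
  \<open>f (s z)\<close> and \<open>f (t z)\<close> with \<open>s < t < 1\<close> differ by at most the integral of \<open>\<Phi>\<close> over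
  \<open>[1 - t, 1 - s]\<close>, and by the maximum modulus principle the same bound holds on the closed disc.
  Since \<open>\<Phi>\<close> is integrable, the dilates are uniformly Cauchy as \<open>s\<close> tends to 1, so they converge
  uniformly to a continuous function on the closed disc, which agrees with \<open>f\<close> inside.
\<close>

text \<open>The integration variable \<open>x\<close> is the distance to the unit circle, the
  variable in which \<Phi> is given. An integral in \<open>ennreal\<close> lets the integrand be
  replaced by \<Phi> later through monotonicity alone.\<close>

lemma radial_increment_le:
  fixes f :: "complex \<Rightarrow> complex" and u :: complex
  assumes f: "f holomorphic_on ball 0 1" and u: "norm u = 1"
    and ab: "0 < a" "a \<le> b" "b \<le> 1"
  shows "ennreal (norm (f (of_real (1 - b) * u) - f (of_real (1 - a) * u)))
    \<le> (\<integral>\<^sup>+ x. ennreal (norm (deriv f (of_real (1 - x) * u))) * indicator {a..b} x \<partial>lborel)"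
proof -
  \<comment> \<open>The derivative of \<open>f\<close> along the radius; the minus sign comes from
    \<open>1 - x\<close>.\<close>
  define D where "D x = - u * deriv f (of_real (1 - x) * u)" for x :: real
  have inside: "of_real (1 - x) * u \<in> ball 0 1" if "x \<in> {a..b}" for x
  proof -
    have "norm (of_real (1 - x) * u) = \<bar>1 - x\<bar>"
      using u by (simp only: norm_mult norm_of_real mult_1_right)
    then show ?thesis using that ab by simp
  qed
  have deriv: "((\<lambda>x. f (of_real (1 - x) * u)) has_vector_derivative D x) (at x within {a..b})"
    if "a \<le> x" "x \<le> b" for x
  proof -
    have "((\<lambda>x. of_real (1 - x) * u) has_vector_derivative - u) (at x)"
      by (auto intro!: derivative_eq_intros)
    moreover have "(f has_field_derivative deriv f (of_real (1 - x) * u)) (at (of_real (1 - x) * u))"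
      using inside that by (intro holomorphic_derivI[OF f]) auto
    ultimately have "((f \<circ> (\<lambda>x. of_real (1 - x) * u)) has_vector_derivative D x) (at x)"
      unfolding D_def by (rule field_vector_diff_chain_at)
    then show ?thesis
      by (auto simp: o_def intro: has_vector_derivative_at_within)
  qed
  have "continuous_on {a..b} (\<lambda>x. deriv f (of_real (1 - x) * u))"
  proof (rule continuous_on_compose2[of "ball 0 1" "deriv f"])
    show "continuous_on (ball 0 1) (deriv f)"
      by (intro holomorphic_on_imp_continuous_on holomorphic_deriv f open_ball)
    show "continuous_on {a..b} (\<lambda>x. of_real (1 - x) * u)"
      by (intro continuous_intros)
  qed (use inside in blast)
  then have cont: "continuous_on {a..b} D"
    unfolding D_def by (intro continuous_intros)
  have "integrable lborel (\<lambda>x. indicator {a..b} x *\<^sub>R D x)"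
    using borel_integrable_atLeastAtMost'[OF cont] by (simp add: set_integrable_def)
  from integral_norm_bound_ennreal[OF this]
  have "ennreal (norm (f (of_real (1 - b) * u) - f (of_real (1 - a) * u)))
      \<le> (\<integral>\<^sup>+ x. norm (indicator {a..b} x *\<^sub>R D x) \<partial>lborel)"
    using integral_FTC_atLeastAtMost[OF ab(2) deriv cont] by simp
  also have "\<dots> = (\<integral>\<^sup>+ x. ennreal (norm (deriv f (of_real (1 - x) * u))) * indicator {a..b} x \<partial>lborel)"
    by (intro nn_integral_cong) (simp add: D_def norm_mult u indicator_def)
  finally show ?thesis .
qed

text \<open>Continuity from above of the finite measure with density \<Phi>. The intervals are open
  at 0 so that their intersection is empty.\<close>

lemma nn_integral_shrinking_interval_tendsto_0:
  fixes \<Phi> :: "real \<Rightarrow> ennreal" and \<delta> :: "nat \<Rightarrow> real"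
  assumes meas: "\<Phi> \<in> borel_measurable (lebesgue_on {0..<r})"
    and fin: "(\<integral>\<^sup>+ x. \<Phi> x \<partial>lebesgue_on {0..<r}) < \<infinity>"
    and \<delta>: "decseq \<delta>" "\<delta> \<longlonglongrightarrow> 0" "\<And>n. \<delta> n < r"
  shows "(\<lambda>n. \<integral>\<^sup>+ x. \<Phi> x * indicator {0<..\<delta> n} x \<partial>lebesgue_on {0..<r}) \<longlonglongrightarrow> 0"
proof -
  let ?M = "lebesgue_on {0..<r}"
  let ?N = "density ?M \<Phi>"
  let ?A = "\<lambda>n. {0<..\<delta> n}"
  have A: "?A n \<in> sets ?M" for n
  proof -
    have "?A n \<subseteq> {0..<r}" using \<delta>(3)[of n] by auto
    then show ?thesis by (auto simp: sets_restrict_space_iff)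
  qed
  have eq: "emeasure ?N (?A n) = (\<integral>\<^sup>+ x. \<Phi> x * indicator (?A n) x \<partial>?M)" for n
    by (rule emeasure_density[OF meas A])
  have empty: "(\<Inter>n. ?A n) = {}"
  proof safe
    fix x assume x: "x \<in> (\<Inter>n. ?A n)"
    then have "x \<le> 0" by (intro LIMSEQ_le_const[OF \<delta>(2)]) auto
    then show "x \<in> {}" using x by auto
  qed
  have "(\<lambda>n. emeasure ?N (?A n)) \<longlonglongrightarrow> emeasure ?N (\<Inter>n. ?A n)"
  proof (rule Lim_emeasure_decseq)
    show "range ?A \<subseteq> sets ?N" using A by auto
    show "decseq ?A" using \<delta>(1) by (fastforce simp: decseq_def)
    fix n
    have "emeasure ?N (?A n) \<le> (\<integral>\<^sup>+ x. \<Phi> x \<partial>?M)"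
      unfolding eq by (intro nn_integral_mono) (auto simp: indicator_def)
    then show "emeasure ?N (?A n) \<noteq> \<infinity>" using fin by auto
  qed
  then show ?thesis by (simp add: eq empty)
qed

text \<open>Meant for differences of two dilates, whose radial estimate is available only on the
  unit circle.\<close>

lemma norm_le_unit_circle_bound:
  fixes h :: "complex \<Rightarrow> complex"
  assumes "h holomorphic_on ball 0 1" "continuous_on (cball 0 1) h"
    and "\<And>u. norm u = 1 \<Longrightarrow> norm (h u) \<le> B" and "z \<in> cball 0 1"
  shows "norm (h z) \<le> B"
proof (rule maximum_modulus_frontier[of h "cball 0 1"])
  show "norm (h u) \<le> B" if "u \<in> frontier (cball 0 1)" for u
    using that by (intro assms(3)) (simp add: frontier_cball)
qed (use assms(1,2,4) in \<open>simp_all add: interior_cball\<close>)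

theorem proposition2p1:
  fixes r0 :: real and \<Phi> :: "real \<Rightarrow> ennreal" and f :: "complex \<Rightarrow> complex"
  assumes "0 < r0" and "r0 < 1"
    and "\<Phi> \<in> borel_measurable (lebesgue_on {0..<r0})"
    and "(\<integral>\<^sup>+ x. \<Phi> x \<partial>lebesgue_on {0..<r0}) < \<infinity>"
    and "f holomorphic_on ball 0 1"
    and "\<And>r \<theta> :: real. 1 - r0 < r \<Longrightarrow> r < 1 \<Longrightarrow>
           ennreal (cmod (deriv f (complex_of_real r * exp (\<i> * complex_of_real \<theta>)))) \<le> \<Phi> (1 - r)"
  shows "\<exists>g. continuous_on (cball 0 1) g \<and> (\<forall>z\<in>ball 0 1. g z = f z)"
proof -
  let ?M = "lebesgue_on {0..<r0}"
  \<comment> \<open>The shift by 2 gives \<open>\<delta> n < r0\<close> already at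
    \<open>n = 0\<close>, so every radius \<open>1 - \<delta> n\<close> lies in the range where the
    bound on the derivative is assumed.\<close>
  define \<delta> where "\<delta> n = r0 / real (n + 2)" for n
  define F where "F n z = f (of_real (1 - \<delta> n) * z)" for n z
  define \<omega> where "\<omega> n = (\<integral>\<^sup>+ x. \<Phi> x * indicator {0<..\<delta> n} x \<partial>?M)" for n
  have \<delta>: "0 < \<delta> n" "\<delta> n < r0" for n
    using assms(1) by (auto simp: \<delta>_def field_simps add_pos_nonneg)
  have \<delta>_le: "\<delta> n \<le> \<delta> m" if "m \<le> n" for m n
    unfolding \<delta>_def using that assms(1) by (intro divide_left_mono) auto
  have \<delta>_lim: "\<delta> \<longlonglongrightarrow> 0"
    unfolding \<delta>_def by (rule LIMSEQ_ignore_initial_segment[OF lim_const_over_n])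
  have \<omega>_lim: "\<omega> \<longlonglongrightarrow> 0"
    unfolding \<omega>_def using \<delta> \<delta>_le \<delta>_lim assms(3,4)
    by (intro nn_integral_shrinking_interval_tendsto_0) (auto simp: decseq_def)
  \<comment> \<open>Since \<open>1 - \<delta> n < 1\<close>, the closed disc is mapped into the open
    one, so \<open>F n\<close> is continuous up to the boundary.\<close>
  have dilate: "of_real (1 - \<delta> n) * z \<in> ball 0 1" if "z \<in> cball 0 1" for n and z :: complex
  proof -
    have "norm (of_real (1 - \<delta> n) * z) = (1 - \<delta> n) * norm z"
      using \<delta>[of n] assms(2) by (simp only: norm_mult norm_of_real)
    also have "\<dots> \<le> (1 - \<delta> n) * 1"
      using \<delta>[of n] assms(2) that by (intro mult_left_mono) auto
    finally show ?thesis using \<delta>[of n] by simp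
  qed
  have cont: "continuous_on (cball 0 1) (F n)" for n
    unfolding F_def
  proof (rule continuous_on_compose2[of "ball 0 1" f])
    show "continuous_on (ball 0 1) f"
      by (rule holomorphic_on_imp_continuous_on[OF assms(5)])
    show "continuous_on (cball 0 1) (\<lambda>z::complex. of_real (1 - \<delta> n) * z)"
      by (intro continuous_intros)
  qed (use dilate in blast)
  have hol: "F n holomorphic_on ball 0 1" for n
  proof -
    have "f \<circ> (\<lambda>z. of_real (1 - \<delta> n) * z) holomorphic_on ball 0 1"
    proof (rule holomorphic_on_compose_gen[OF _ assms(5)])
      show "(\<lambda>z::complex. of_real (1 - \<delta> n) * z) ` ball 0 1 \<subseteq> ball 0 1"
        using dilate ball_subset_cball by blast
    qed (intro holomorphic_intros)
    then show ?thesis unfolding F_def o_def .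
  qed
  have circle: "ennreal (norm (F m u - F n u)) \<le> \<omega> m" if "m \<le> n" and u: "norm u = 1" for m n u
  proof -
    have "ennreal (norm (F m u - F n u))
        \<le> (\<integral>\<^sup>+ x. ennreal (norm (deriv f (of_real (1 - x) * u))) * indicator {\<delta> n..\<delta> m} x \<partial>lborel)"
      unfolding F_def using \<delta>[of m] \<delta>[of n] \<delta>_le[OF \<open>m \<le> n\<close>] assms(2)
      by (intro radial_increment_le assms(5) u) auto
    \<comment> \<open>Enlarging \<open>{\<delta> n..\<delta> m}\<close> to
      \<open>{0<..\<delta> m}\<close> makes the bound independent of \<open>n\<close>. The second
      indicator encodes the domain of \<Phi>.\<close>
    also have "\<dots> \<le> (\<integral>\<^sup>+ x. \<Phi> x * indicator {0<..\<delta> m} x * indicator {0..<r0} x \<partial>lborel)"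
    proof (intro nn_integral_mono)
      fix x
      show "ennreal (norm (deriv f (of_real (1 - x) * u))) * indicator {\<delta> n..\<delta> m} x
        \<le> \<Phi> x * indicator {0<..\<delta> m} x * indicator {0..<r0} x"
      proof (cases "x \<in> {\<delta> n..\<delta> m}")
        case True
        then have x: "0 < x" "x < r0" using \<delta>[of m] \<delta>[of n] by auto
        \<comment> \<open>Polar form of \<open>u\<close>, so that the hypothesis applies with
          \<open>r = 1 - x\<close> and bounds the derivative by \<open>\<Phi> x\<close>.\<close>
        have "u = exp (\<i> * of_real (Arg u))"
          using Arg_eq[of u] u by force
        then have "ennreal (norm (deriv f (of_real (1 - x) * u))) \<le> \<Phi> x"
          using assms(6)[of "1 - x" "Arg u"] x by simp
        then show ?thesis using True x by simp
      qed simp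
    qed
    \<comment> \<open>Restriction turns into an indicator, and passing to the completion of
      \<open>lborel\<close> does not change the integral.\<close>
    also have "\<dots> = \<omega> m"
      by (simp add: \<omega>_def nn_integral_restrict_space nn_integral_completion)
    finally show ?thesis .
  qed
  have "uniformly_Cauchy_on (cball 0 1) F"
  proof (rule uniformly_Cauchy_onI')
    fix e :: real assume e: "e > 0"
    \<comment> \<open>Half of \<open>e\<close> is used because the maximum modulus principle yields
      only a non-strict bound.\<close>
    have "\<forall>\<^sub>F n in sequentially. \<omega> n < ennreal (e / 2)"
      using e by (intro order_tendstoD(2)[OF \<omega>_lim]) auto
    then obtain N where N: "\<And>n. n \<ge> N \<Longrightarrow> \<omega> n < ennreal (e / 2)"
      by (auto simp: eventually_sequentially)
    have "dist (F m z) (F n z) < e" if "z \<in> cball 0 1" "m \<ge> N" "n > m" for z m n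
    proof -
      have "norm (F m z - F n z) \<le> e / 2"
      proof (rule norm_le_unit_circle_bound[of "\<lambda>z. F m z - F n z"])
        fix u :: complex assume u: "norm u = 1"
        have "ennreal (norm (F m u - F n u)) \<le> ennreal (e / 2)"
          using circle[of m n u] N[of m] that u by (simp add: order.trans less_imp_le)
        then show "norm (F m u - F n u) \<le> e / 2"
          using e by (simp add: ennreal_le_iff)
      qed (use that in \<open>auto intro!: holomorphic_intros continuous_intros hol cont\<close>)
      then show ?thesis using e by (simp add: dist_norm)
    qed
    then show "\<exists>M. \<forall>x\<in>cball 0 1. \<forall>m\<ge>M. \<forall>n>m. dist (F m x) (F n x) < e"
      by blast
  qed
  then obtain g where g: "uniform_limit (cball 0 1) F g sequentially"
    using Cauchy_uniformly_convergent uniformly_convergent_on_def by blast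
  have "continuous_on (cball 0 1) g"
    by (rule uniform_limit_theorem[OF _ g]) (simp_all add: cont)
  moreover have "g z = f z" if z: "z \<in> ball 0 1" for z
  proof -
    have "(\<lambda>n. F n z) \<longlonglongrightarrow> g z"
      using z by (intro tendsto_uniform_limitI[OF g]) auto
    \<comment> \<open>The dilated points tend to \<open>z\<close>, where \<open>f\<close> is
      continuous, so the limit of \<open>F n z\<close> is also \<open>f z\<close>.\<close>
    moreover have "(\<lambda>n. of_real (1 - \<delta> n) * z) \<longlonglongrightarrow> of_real (1 - 0) * z"
      by (intro tendsto_intros \<delta>_lim)
    then have "(\<lambda>n. F n z) \<longlonglongrightarrow> f z"
      unfolding F_def using z assms(5)
      by (intro isCont_tendsto_compose[of z f])
         (auto simp: continuous_on_interior dest!: holomorphic_on_imp_continuous_on)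
    ultimately show ?thesis by (rule LIMSEQ_unique)
  qed
  ultimately show ?thesis by blast
qed

end
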